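(* Let $\alpha,\beta\in(0,1)$ be fixed with $\alpha\neq 1/2$ and $\beta=1-\alpha$. Let $F,G:\mathbb{R}\to\mathbb{R}$ be differentiable functions with $f=F'$, $g=G'$ such that $$[F(b)-F(a)]\,g(\alpha a+\beta b)=[G(b)-G(a)]\,f(\alpha a+\beta b)\quad\text{for all } a,b\in\mathbb{R},\ a<b.$$ If $F,G$ are two times continuously differentiable on $\mathbb{R}$, then $\{F,G,1\}$ are linearly dependent on $\mathbb{R}$, i.e. there exist constants $A,B,C\in\mathbb{R}$, not all zero, such that $$AF(x)+BG(x)+C=0\quad\text{for all } x\in\mathbb{R}.$$
   Context: $1$ denotes the constant function equal to $1$. *)

theory Defs
  imports "HOL-Analysis.Analysis"
begin

(* Mirrors C1_differentiable_on from HOL-Analysis.Smooth_Paths, including its use of the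
   two-sided derivative at the points of S. *)
definition C2_differentiable_on ::
    "(real \<Rightarrow> 'a::real_normed_vector) \<Rightarrow> real set \<Rightarrow> bool"
    (infix "C2'_differentiable'_on" 50)
  where "F C2_differentiable_on S \<longleftrightarrow>
    (\<exists>D. (\<forall>x\<in>S. (F has_vector_derivative D x) (at x)) \<and> D C1_differentiable_on S)"

end

theory Submission
  imports Defs
begin

text \<open>
  Put \<open>x = \<alpha> a + \<beta> b\<close> and \<open>t = b - a\<close>, so that \<open>b = x + \<alpha> t\<close> and \<open>a = x - \<beta> t\<close>. Differentiating
  the equation once in \<open>t\<close> and then once more at \<open>t = 0\<close> gives
  \<open>(\<alpha>\<^sup>2 - \<beta>\<^sup>2) (f' g - g' f) = 0\<close>, so the Wronskian vanishes. This alone does not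
  suffice, since \<open>f\<close> and \<open>g\<close> may have common zeros. But fix \<open>x\<close> with \<open>(f x, g x) \<noteq> 0\<close> and put
  \<open>w y = f y * g x - g y * f x\<close>. The \<open>t\<close>-derivative of the equation
  reads \<open>\<alpha> w (x + \<alpha> t) + \<beta> w (x - \<beta> t) = 0\<close>, and, the Wronskian being zero at \<open>x\<close>, the
  \<open>x\<close>-derivative reduces to \<open>w (x + \<alpha> t) = w (x - \<beta> t)\<close>. Hence \<open>w\<close> vanishes on the whole line and
  \<open>g x * F - f x * G\<close> is constant.
\<close>

text \<open>The definition only asserts that some C1 derivative \<open>D\<close> exists; uniqueness
  of derivatives identifies it with the given \<open>f\<close>.\<close>

lemma C2_differentiable_on_UNIV_imp_derivative_differentiable:
  fixes F f :: "real \<Rightarrow> real"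
  assumes "F C2_differentiable_on UNIV" and F: "\<And>x. (F has_real_derivative f x) (at x)"
  obtains f' where "\<And>x. (f has_real_derivative f' x) (at x)"
proof -
  obtain D where D: "\<And>x. (F has_vector_derivative D x) (at x)" "D C1_differentiable_on UNIV"
    using assms(1) by (auto simp: C2_differentiable_on_def)
  have "D = f"
    using DERIV_unique[OF _ F] D(1)
    by (intro ext) (simp add: has_real_derivative_iff_has_vector_derivative)
  with D(2) show thesis
    using that by (auto simp: C1_differentiable_on_def has_real_derivative_iff_has_vector_derivative)
qed

text \<open>The hypothesis a < b gives identities only for t \<ge> 0, so at t = 0 they are
  one-sided. A two-sided derivative is already determined by its restriction to the right.\<close>

lemma DERIV_zero_of_zero_on_nonneg:
  fixes h :: "real \<Rightarrow> real"
  assumes "(h has_real_derivative d) (at t)" and "t \<ge> 0" and "\<And>s. s \<ge> 0 \<Longrightarrow> h s = 0"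
  shows "d = 0"
proof -
  have "(h has_real_derivative d) (at t within {t..})"
    using assms(1) by (rule has_field_derivative_at_within)
  then have "((\<lambda>_. 0) has_real_derivative d) (at t within {t..})"
    by (rule has_field_derivative_transform_within[where d = 1]) (use assms in auto)
  moreover have "at t within {t..} \<noteq> bot"
    by (simp add: at_within_Ici_at_right)
  ultimately show ?thesis
    by (simp add: has_field_derivative_iff tendsto_const_iff)
qed

locale weighted_mean_value =
  fixes \<alpha> \<beta> :: real and F G f g f' g' :: "real \<Rightarrow> real"
  assumes pos: "\<alpha> > 0" "\<beta> > 0" and sum_one: "\<alpha> + \<beta> = 1"
    and F: "\<And>x. (F has_real_derivative f x) (at x)"
    and G: "\<And>x. (G has_real_derivative g x) (at x)"
    and f: "\<And>x. (f has_real_derivative f' x) (at x)"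
    and g: "\<And>x. (g has_real_derivative g' x) (at x)"
    and mean_value: "\<And>a b. a < b \<Longrightarrow>
      (F b - F a) * g (\<alpha> * a + \<beta> * b) = (G b - G a) * f (\<alpha> * a + \<beta> * b)"
begin

lemma centered:
  assumes "t \<ge> 0"
  shows "(F (x + \<alpha> * t) - F (x - \<beta> * t)) * g x = (G (x + \<alpha> * t) - G (x - \<beta> * t)) * f x"
proof (cases "t = 0")
  case False
  have "x - \<beta> * t < x + \<alpha> * t"
    using False assms pos by (smt (verit) mult_pos_pos)
  moreover have "\<alpha> * (x - \<beta> * t) + \<beta> * (x + \<alpha> * t) = (\<alpha> + \<beta>) * x"
    by (simp add: algebra_simps)
  ultimately show ?thesis
    using mean_value[of "x - \<beta> * t" "x + \<alpha> * t"] by (simp add: sum_one)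
qed simp

lemma centered_deriv_t:
  assumes "t \<ge> 0"
  shows "(\<alpha> * f (x + \<alpha> * t) + \<beta> * f (x - \<beta> * t)) * g x =
    (\<alpha> * g (x + \<alpha> * t) + \<beta> * g (x - \<beta> * t)) * f x"
proof -
  note [derivative_intros] = DERIV_chain2[OF F] DERIV_chain2[OF G]
  have "((\<lambda>t. (F (x + \<alpha> * t) - F (x - \<beta> * t)) * g x - (G (x + \<alpha> * t) - G (x - \<beta> * t)) * f x)
      has_real_derivative (\<alpha> * f (x + \<alpha> * t) + \<beta> * f (x - \<beta> * t)) * g x -
        (\<alpha> * g (x + \<alpha> * t) + \<beta> * g (x - \<beta> * t)) * f x) (at t)"
    by (auto intro!: derivative_eq_intros simp: algebra_simps)
  from DERIV_zero_of_zero_on_nonneg[OF this assms] show ?thesis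
    by (simp add: centered)
qed

lemma wronskian_eq_0:
  assumes "\<alpha> \<noteq> \<beta>"
  shows "f' x * g x = g' x * f x"
proof -
  note [derivative_intros] = DERIV_chain2[OF f] DERIV_chain2[OF g]
  \<comment> \<open>The chain rule yields the factor \<alpha>^2 - \<beta>^2, nonzero because
    \<alpha> + \<beta> = 1 and \<alpha> differs from \<beta>.\<close>
  have "((\<lambda>t. (\<alpha> * f (x + \<alpha> * t) + \<beta> * f (x - \<beta> * t)) * g x -
        (\<alpha> * g (x + \<alpha> * t) + \<beta> * g (x - \<beta> * t)) * f x)
      has_real_derivative (\<alpha> + \<beta>) * (\<alpha> - \<beta>) * (f' x * g x - g' x * f x)) (at 0)"
    by (auto intro!: derivative_eq_intros simp: algebra_simps)
  from DERIV_zero_of_zero_on_nonneg[OF this] show ?thesis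
    using assms by (simp add: centered_deriv_t sum_one)
qed

lemma centered_deriv_x:
  assumes "t \<ge> 0"
  shows "(f (x + \<alpha> * t) - f (x - \<beta> * t)) * g x + (F (x + \<alpha> * t) - F (x - \<beta> * t)) * g' x =
    (g (x + \<alpha> * t) - g (x - \<beta> * t)) * f x + (G (x + \<alpha> * t) - G (x - \<beta> * t)) * f' x"
proof -
  note [derivative_intros] = DERIV_chain2[OF F] DERIV_chain2[OF G] DERIV_chain2[OF f] DERIV_chain2[OF g]
  let ?d = "(f (x + \<alpha> * t) - f (x - \<beta> * t)) * g x + (F (x + \<alpha> * t) - F (x - \<beta> * t)) * g' x -
    ((g (x + \<alpha> * t) - g (x - \<beta> * t)) * f x + (G (x + \<alpha> * t) - G (x - \<beta> * t)) * f' x)"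
  have "((\<lambda>x. (F (x + \<alpha> * t) - F (x - \<beta> * t)) * g x - (G (x + \<alpha> * t) - G (x - \<beta> * t)) * f x)
      has_real_derivative ?d) (at x)"
    by (auto intro!: derivative_eq_intros simp: algebra_simps)
  then have "((\<lambda>_. 0) has_real_derivative ?d) (at x)"
    by (simp add: centered assms)
  from DERIV_unique[OF this DERIV_const] have "?d = 0" .
  then show ?thesis by simp
qed

lemma derivatives_proportional:
  assumes "\<alpha> \<noteq> \<beta>" and nz: "f x \<noteq> 0 \<or> g x \<noteq> 0"
  shows "f y * g x = g y * f x"
proof -
  define w where "w y = f y * g x - g y * f x" for y
  have w_eq_0: "w (x + \<alpha> * t) = 0 \<and> w (x - \<beta> * t) = 0" if "t \<ge> 0" for t
  proof -
    define P Q where "P = F (x + \<alpha> * t) - F (x - \<beta> * t)" and "Q = G (x + \<alpha> * t) - G (x - \<beta> * t)"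
    have PQ: "P * g x = Q * f x"
      using centered[OF that] by (simp add: P_def Q_def)
    have W: "f' x * g x = g' x * f x"
      using wronskian_eq_0[OF assms(1)] .
    \<comment> \<open>Both (P, Q) and (f' x, g' x) are parallel to the nonzero vector (f x, g x),
      hence to each other.\<close>
    have "f x * (P * g' x - Q * f' x) = 0" "g x * (P * g' x - Q * f' x) = 0"
      using PQ W by algebra+
    with nz have "P * g' x = Q * f' x" by auto
    then have "w (x + \<alpha> * t) = w (x - \<beta> * t)"
      using centered_deriv_x[OF that, of x] by (simp add: w_def P_def Q_def algebra_simps)
    moreover have "\<alpha> * w (x + \<alpha> * t) + \<beta> * w (x - \<beta> * t) = 0"
      using centered_deriv_t[OF that, of x] by (simp add: w_def algebra_simps)
    \<comment> \<open>Two equal numbers whose weighted mean is zero both vanish.\<close>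
    ultimately show ?thesis
      using sum_one by (simp flip: distrib_right)
  qed
  have "w y = 0"
  \<comment> \<open>Points to the right of x have the form x + \<alpha> t, points to the left x -
    \<beta> t, with t \<ge> 0.\<close>
  proof (cases "y \<ge> x")
    case True
    then show ?thesis using w_eq_0[of "(y - x) / \<alpha>"] pos by simp
  next
    case False
    then show ?thesis using w_eq_0[of "(x - y) / \<beta>"] pos by simp
  qed
  then show ?thesis by (simp add: w_def)
qed

end

theorem theorem7:
  fixes \<alpha> \<beta> :: real and F G f g :: "real \<Rightarrow> real"
  assumes "\<alpha> \<in> {0<..<1}" and "\<beta> \<in> {0<..<1}" and "\<alpha> \<noteq> 1/2" and "\<beta> = 1 - \<alpha>"
    and "\<And>x. (F has_real_derivative f x) (at x)"
    and "\<And>x. (G has_real_derivative g x) (at x)"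
    and "\<And>a b. a < b \<Longrightarrow>
      (F b - F a) * g (\<alpha> * a + \<beta> * b) = (G b - G a) * f (\<alpha> * a + \<beta> * b)"
    and "F C2_differentiable_on UNIV" and "G C2_differentiable_on UNIV"
  shows "\<exists>A B C :: real. \<not> (A = 0 \<and> B = 0 \<and> C = 0) \<and> (\<forall>x. A * F x + B * G x + C = 0)"
proof -
  obtain f' where f': "\<And>x. (f has_real_derivative f' x) (at x)"
    using C2_differentiable_on_UNIV_imp_derivative_differentiable[OF assms(8,5)] by blast
  obtain g' where g': "\<And>x. (g has_real_derivative g' x) (at x)"
    using C2_differentiable_on_UNIV_imp_derivative_differentiable[OF assms(9,6)] by blast
  interpret weighted_mean_value \<alpha> \<beta> F G f g f' g'
    using assms f' g' by unfold_locales auto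
  have "\<exists>A B. \<not> (A = 0 \<and> B = 0) \<and> (\<forall>y. A * f y + B * g y = 0)"
  proof (cases "\<exists>x. f x \<noteq> 0 \<or> g x \<noteq> 0")
    case True
    then obtain x where x: "f x \<noteq> 0 \<or> g x \<noteq> 0" by blast
    have "\<alpha> \<noteq> \<beta>" using assms(3,4) by simp
    from derivatives_proportional[OF this x] x show ?thesis
      by (intro exI[of _ "g x"] exI[of _ "- f x"]) (auto simp: algebra_simps)
  next
    case False
    then show ?thesis by (intro exI[of _ 1]) auto
  qed
  then obtain A B where AB: "\<not> (A = 0 \<and> B = 0)" and lin: "\<And>y. A * f y + B * g y = 0"
    by blast
  have "((\<lambda>x. A * F x + B * G x) has_real_derivative 0) (at x)" for x
    using DERIV_add[OF DERIV_cmult[OF F[of x], of A] DERIV_cmult[OF G[of x], of B]]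
    by (simp add: lin)
  then have "A * F x + B * G x = A * F 0 + B * G 0" for x
    using DERIV_isconst_all[of "\<lambda>x. A * F x + B * G x" x 0] by blast
  \<comment> \<open>Take C = -(A * F 0 + B * G 0).\<close>
  then show ?thesis
    using AB by (metis add.right_inverse)
qed

end
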